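(* Let $T_L$ be a BSTM with $n$ nodes. Suppose there are $k$ simple nodes in $T_L$ that are not leaves. Let $R(T_L)$ denote the number of distinct BSTMs $T_R$ such that $(T_L,T_R)$ is a pair of twin BSTMs. Then $$C_{n-k} \leq R(T_L) \leq C_n,$$ where $C_m = \frac{(2m)!}{(m+1)!\,m!}$ is the $m$-th Catalan number.
   Context: Binary trees are rooted planar binary trees (left and right children distinguished); the $i$-th node of a binary tree is the $i$-th node in its inorder traversal. A binary search tree with multiplicities (BSTM) is a binary tree whose nodes are labelled by pairwise distinct letters of $\mathbb{N}=\{1,2,\dots\}$ forming a binary search tree (left subtree letters strictly smaller, right subtree letters strictly greater), each node also carrying a positive integer, its multiplicity. A node is simple if its multiplicity is 1. $\mathrm{cont}(T)$ is the function giving for each letter its multiplicity in $T$ ($0$ if absent). A pair $(T_L,T_R)$ of BSTMs is a pair of twin BSTMs if $\mathrm{cont}(T_L)=\mathrm{cont}(T_R)$ and, for all $i$, the $i$-th nodes of $T_L$ and $T_R$ have the same multiplicity and, if the $i$-th node of $T_L$ has multiplicity 1 and has a left (resp. right) child, then the $i$-th node of $T_R$ has no left (resp. right) child. *)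

theory Defs
  imports Complex_Main "HOL-Library.Tree"
begin

text \<open>
  A node of a BSTM carries a pair: its letter and its multiplicity.
  The letters range over the positive integers. The empty tree is allowed.
\<close>

type_synonym labelled_tree = "(nat \<times> nat) tree"

definition bstm :: "labelled_tree \<Rightarrow> bool" where
  "bstm T \<longleftrightarrow> bst (map_tree fst T) \<and> (\<forall>(a, m) \<in> set_tree T. 0 < a \<and> 0 < m)"

text \<open>The letters of a BSTM are distinct, so the lookup below meets at most one entry.\<close>

definition cont :: "labelled_tree \<Rightarrow> nat \<Rightarrow> nat" where
  "cont T a = (case map_of (inorder T) a of None \<Rightarrow> 0 | Some m \<Rightarrow> m)"

text \<open>
  A node is represented by the subtree rooted at it, so that its children can be inspected.
  Nodes are indexed from 0.
\<close>

fun inorder_nodes :: "'a tree \<Rightarrow> 'a tree list" where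
  "inorder_nodes Leaf = []"
| "inorder_nodes (Node l a r) = inorder_nodes l @ Node l a r # inorder_nodes r"

definition node_at :: "'a tree \<Rightarrow> nat \<Rightarrow> 'a tree" where
  "node_at T i = inorder_nodes T ! i"

definition mult_at :: "labelled_tree \<Rightarrow> nat \<Rightarrow> nat" where
  "mult_at T i = snd (value (node_at T i))"

definition has_left_child :: "'a tree \<Rightarrow> nat \<Rightarrow> bool" where
  "has_left_child T i \<longleftrightarrow> left (node_at T i) \<noteq> Leaf"

definition has_right_child :: "'a tree \<Rightarrow> nat \<Rightarrow> bool" where
  "has_right_child T i \<longleftrightarrow> right (node_at T i) \<noteq> Leaf"

definition simple_node :: "labelled_tree \<Rightarrow> nat \<Rightarrow> bool" where
  "simple_node T i \<longleftrightarrow> mult_at T i = 1"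

text \<open>A node without children, as opposed to the constructor \<open>Leaf\<close>, which is the empty tree.\<close>

definition leaf_node :: "'a tree \<Rightarrow> nat \<Rightarrow> bool" where
  "leaf_node T i \<longleftrightarrow> \<not> has_left_child T i \<and> \<not> has_right_child T i"

text \<open>
  Equality of contents forces both trees to have the same number of nodes,
  so every \<open>i < size T\<^sub>L\<close> is also a valid index in \<open>T\<^sub>R\<close>.
\<close>

definition twin_bstms :: "labelled_tree \<Rightarrow> labelled_tree \<Rightarrow> bool" where
  "twin_bstms T\<^sub>L T\<^sub>R \<longleftrightarrow>
     bstm T\<^sub>L \<and> bstm T\<^sub>R \<and> cont T\<^sub>L = cont T\<^sub>R \<and>
     (\<forall>i < size T\<^sub>L.
        mult_at T\<^sub>L i = mult_at T\<^sub>R i \<and>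
        (mult_at T\<^sub>L i = 1 \<and> has_left_child T\<^sub>L i \<longrightarrow> \<not> has_left_child T\<^sub>R i) \<and>
        (mult_at T\<^sub>L i = 1 \<and> has_right_child T\<^sub>L i \<longrightarrow> \<not> has_right_child T\<^sub>R i))"

definition num_right_twins :: "labelled_tree \<Rightarrow> nat" where
  "num_right_twins T\<^sub>L = card {T\<^sub>R. twin_bstms T\<^sub>L T\<^sub>R}"

definition catalan :: "nat \<Rightarrow> real" where
  "catalan m = fact (2 * m) / (fact (m + 1) * fact m)"

end

(* The canopy of a binary tree records, for each pair of consecutive nodes, which of the two
   has its child between them: exactly one of "node i has a right child" and "node i+1 has a
   left child" holds. A right twin of T_L is a tree with the same inorder list in which some
   simple nodes must lack certain children, so there are at most C_n of them. Call a node free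
   if nothing is demanded of it, i.e. if it is not simple or has no children in T_L. Since a
   free node may be a root without restriction, counting only the trees in which no free
   node lies below a restricted one gives the Catalan recurrence in the number n - k of free
   nodes; a run of restricted nodes admits at least one tree, because by the canopy property
   of T_L the demands on consecutive nodes are compatible. *)

theory Submission
  imports Defs
begin

section \<open>The Catalan recurrence\<close>

lemma catalan_0: "catalan 0 = 1"
  by (simp add: catalan_def)

lemma catalan_Suc: "real (n + 2) * catalan (Suc n) = real (4 * n + 2) * catalan n"
proof -
  have "fact (2 * Suc n) = real (2 * n + 2) * real (2 * n + 1) * fact (2 * n)"
    by (simp add: algebra_simps)
  moreover have "fact (Suc n + 1) = real (n + 2) * real (n + 1) * fact n"
    by (simp add: algebra_simps)
  moreover have "fact (Suc n) = real (n + 1) * fact n" "fact (n + 1) = real (n + 1) * fact n"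
    by simp_all
  ultimately show ?thesis
    unfolding catalan_def by (simp only:) (simp add: divide_simps, simp add: algebra_simps)
qed

text \<open>The convolution is symmetric under \<open>i\<close> to \<open>n - i\<close>, and the
  weights \<open>i + 1\<close> and \<open>n - i + 1\<close> add up to \<open>n + 2\<close>.\<close>

lemma catalan_weighted_convolution:
  "2 * (\<Sum>i\<le>n. real (i + 1) * (catalan i * catalan (n - i)))
     = real (n + 2) * (\<Sum>i\<le>n. catalan i * catalan (n - i))"
proof -
  let ?f = "\<lambda>i. real (i + 1) * (catalan i * catalan (n - i))"
  have "(\<Sum>i\<le>n. ?f i) = (\<Sum>i\<le>n. ?f (n - i))"
    by (rule sum.reindex_bij_witness[of _ "\<lambda>i. n - i" "\<lambda>i. n - i"]) auto
  then have "2 * (\<Sum>i\<le>n. ?f i) = (\<Sum>i\<le>n. ?f i + ?f (n - i))"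
    by (simp add: sum.distrib)
  also have "\<dots> = (\<Sum>i\<le>n. real (n + 2) * (catalan i * catalan (n - i)))"
    by (rule sum.cong) (auto simp: algebra_simps of_nat_diff)
  finally show ?thesis
    by (simp add: sum_distrib_left)
qed

text \<open>The weights \<open>i + 1\<close> let the two-term recurrence \<open>catalan_Suc\<close>
  act on the first factor of each term, so the weighted sum for \<open>Suc n\<close> reduces to sums
  for \<open>n\<close>. No generating function is involved.\<close>

lemma catalan_convolution: "(\<Sum>i\<le>n. catalan i * catalan (n - i)) = catalan (Suc n)"
proof (induction n)
  case 0
  show ?case using catalan_Suc[of 0] by (simp add: catalan_0)
next
  case (Suc n)
  let ?S = "\<lambda>n. \<Sum>i\<le>n. catalan i * catalan (n - i)"
  let ?W = "\<lambda>n. \<Sum>i\<le>n. real (i + 1) * (catalan i * catalan (n - i))"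
  \<comment> \<open>The term for index 0 is split off. In the shifted sum the weight
    \<open>i + 2\<close> is the factor on the left of \<open>catalan_Suc\<close>, and 4i + 2 = 4(i +
    1) - 2 separates what results into \<open>?W n\<close> and \<open>?S n\<close>.\<close>
  have "?W (Suc n) = catalan (Suc n)
      + (\<Sum>i\<le>n. (real (i + 2) * catalan (Suc i)) * catalan (n - i))"
    by (simp add: sum.atMost_Suc_shift catalan_0 algebra_simps del: sum.atMost_Suc)
  also have "(\<Sum>i\<le>n. (real (i + 2) * catalan (Suc i)) * catalan (n - i))
      = (\<Sum>i\<le>n. 4 * (real (i + 1) * (catalan i * catalan (n - i)))
          - 2 * (catalan i * catalan (n - i)))"
    unfolding catalan_Suc by (simp add: algebra_simps)
  also have "\<dots> = 4 * ?W n - 2 * ?S n"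
    by (simp only: sum_subtractf sum_distrib_left)
  \<comment> \<open>Doubling makes both weighted sums available to the symmetry lemma.\<close>
  finally have "real (n + 3) * ?S (Suc n) = 2 * catalan (Suc n) + 4 * (2 * ?W n) - 4 * ?S n"
    using catalan_weighted_convolution[of "Suc n"] by (simp add: algebra_simps)
  also have "\<dots> = real (4 * n + 6) * catalan (Suc n)"
    unfolding catalan_weighted_convolution Suc.IH by (simp add: algebra_simps)
  also have "\<dots> = real (n + 3) * catalan (Suc (Suc n))"
    using catalan_Suc[of "Suc n"] by (simp add: algebra_simps)
  finally show ?case by (simp only: mult_cancel_left) simp
qed

lemma catalan_convolution_lessThan:
  "(\<Sum>i<Suc n. catalan i * catalan (n - i)) = catalan (Suc n)"
  using catalan_convolution[of n] by (simp add: lessThan_Suc_atMost)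

section \<open>Nodes in inorder\<close>

lemma map_value_inorder_nodes: "map value (inorder_nodes t) = inorder t"
  by (induction t) auto

lemma length_inorder_nodes [simp]: "length (inorder_nodes t) = size t"
  by (induction t) auto

lemma value_node_at: "i < size t \<Longrightarrow> value (node_at t i) = inorder t ! i"
  by (simp add: node_at_def flip: map_value_inorder_nodes)

lemma node_at_in_nodes: "i < size t \<Longrightarrow> node_at t i \<in> set (inorder_nodes t)"
  by (simp add: node_at_def)

lemma inorder_nodes_eq_Nil_iff [simp]: "inorder_nodes t = [] \<longleftrightarrow> t = Leaf"
  by (cases t) auto

lemma left_hd_inorder_nodes: "t \<noteq> Leaf \<Longrightarrow> left (hd (inorder_nodes t)) = Leaf"
proof (induction t)
  case (Node l a r)
  then show ?case by (cases "l = Leaf") auto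
qed simp

lemma right_last_inorder_nodes: "t \<noteq> Leaf \<Longrightarrow> right (last (inorder_nodes t)) = Leaf"
proof (induction t)
  case (Node l a r)
  then show ?case by (cases "r = Leaf") auto
qed simp

text \<open>The neighbouring pairs not inside one subtree are the last node of \<open>l\<close> with
  the root, and the root with the first node of \<open>r\<close>. The former node has no right
  child, the latter no left child.\<close>

lemma inorder_nodes_canopy:
  "successively (\<lambda>s t. right s = Leaf \<or> left t = Leaf) (inorder_nodes t)"
proof (induction t)
  case (Node l a r)
  then show ?case
    using left_hd_inorder_nodes[of r] right_last_inorder_nodes[of l]
    by (auto simp: successively_append_iff successively_Cons)
qed simp

section \<open>Trees with forbidden children\<close>

text \<open>The prohibitions depend on labels, not on positions, so they pass unchanged to subtrees
  when the list is cut at the root.\<close>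

definition restricted_trees :: "('a \<Rightarrow> bool) \<Rightarrow> ('a \<Rightarrow> bool) \<Rightarrow> 'a list \<Rightarrow> 'a tree set" where
  "restricted_trees A B xs = {t. inorder t = xs \<and>
     (\<forall>s\<in>set (inorder_nodes t). (A (value s) \<longrightarrow> left s = Leaf) \<and> (B (value s) \<longrightarrow> right s = Leaf))}"

lemma restricted_trees_Nil [simp]: "restricted_trees A B [] = {Leaf}"
  by (auto simp: restricted_trees_def)

lemma Node_in_restricted_trees:
  "Node l a r \<in> restricted_trees A B xs \<longleftrightarrow>
     (A a \<longrightarrow> l = Leaf) \<and> (B a \<longrightarrow> r = Leaf) \<and>
     (\<exists>ys zs. xs = ys @ a # zs \<and> l \<in> restricted_trees A B ys \<and> r \<in> restricted_trees A B zs)"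
  by (auto simp: restricted_trees_def)

lemma Node_in_restricted_treesI:
  assumes "l \<in> restricted_trees A B ys" "r \<in> restricted_trees A B zs"
    and "A a \<Longrightarrow> l = Leaf" "B a \<Longrightarrow> r = Leaf"
  shows "Node l a r \<in> restricted_trees A B (ys @ a # zs)"
  using assms unfolding Node_in_restricted_trees by blast

lemma inorder_in_restricted_trees: "t \<in> restricted_trees A B xs \<Longrightarrow> inorder t = xs"
  by (simp add: restricted_trees_def)

lemma size_in_restricted_trees: "t \<in> restricted_trees A B xs \<Longrightarrow> size t = length xs"
  using inorder_in_restricted_trees length_inorder by metis

text \<open>The prohibitions on the root itself are deliberately left out. The union over all
  \<open>i\<close> is therefore an upper estimate, and the union over free entries a lower
  one.\<close>

abbreviation trees_with_root_at ::
  "('a \<Rightarrow> bool) \<Rightarrow> ('a \<Rightarrow> bool) \<Rightarrow> 'a list \<Rightarrow> nat \<Rightarrow> 'a tree set" where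
  "trees_with_root_at A B xs i \<equiv> (\<lambda>(l, r). Node l (xs ! i) r) `
     (restricted_trees A B (take i xs) \<times> restricted_trees A B (drop (Suc i) xs))"

lemma restricted_trees_subset_roots:
  assumes "xs \<noteq> []"
  shows "restricted_trees A B xs \<subseteq> (\<Union>i<length xs. trees_with_root_at A B xs i)"
proof
  fix t assume t: "t \<in> restricted_trees A B xs"
  then have "t \<noteq> Leaf" using assms inorder_in_restricted_trees by fastforce
  then obtain l a r where lar: "t = Node l a r" by (cases t) auto
  with t obtain ys zs where "xs = ys @ a # zs" "l \<in> restricted_trees A B ys"
    "r \<in> restricted_trees A B zs"
    by (auto simp: Node_in_restricted_trees)
  then show "t \<in> (\<Union>i<length xs. trees_with_root_at A B xs i)"
    using lar by (auto intro!: bexI[of _ "length ys"])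
qed

lemma trees_with_free_root_subset:
  assumes "i < length xs" "\<not> A (xs ! i)" "\<not> B (xs ! i)"
  shows "trees_with_root_at A B xs i \<subseteq> restricted_trees A B xs"
proof -
  have "xs = take i xs @ xs ! i # drop (Suc i) xs"
    using assms(1) by (rule id_take_nth_drop)
  then show ?thesis
    using assms(2,3) Node_in_restricted_treesI[of _ A B "take i xs" _ "drop (Suc i) xs" "xs ! i"]
    by auto
qed

lemma finite_restricted_trees: "finite (restricted_trees A B xs)"
proof (induction xs rule: length_induct)
  case (1 xs)
  show ?case
  proof (cases "xs = []")
    case False
    have "finite (\<Union>i<length xs. trees_with_root_at A B xs i)"
      using 1 by (auto intro!: finite_imageI finite_cartesian_product)
    then show ?thesis
      using restricted_trees_subset_roots[OF False] finite_subset by blast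
  qed simp
qed

lemma card_trees_with_root_in:
  assumes I: "I \<subseteq> {..<length xs}"
  shows "card (\<Union>i\<in>I. trees_with_root_at A B xs i) =
    (\<Sum>i\<in>I. card (restricted_trees A B (take i xs)) * card (restricted_trees A B (drop (Suc i) xs)))"
proof -
  have "card (\<Union>i\<in>I. trees_with_root_at A B xs i) = (\<Sum>i\<in>I. card (trees_with_root_at A B xs i))"
  proof (rule card_UN_disjoint)
    show "finite I" using I finite_subset by blast
    show "\<forall>i\<in>I. finite (trees_with_root_at A B xs i)"
      by (auto intro!: finite_imageI finite_cartesian_product finite_restricted_trees)
    \<comment> \<open>The size of the left subtree recovers the root's index, so different indices
      give disjoint sets.\<close>
    have "size l = i" if "l \<in> restricted_trees A B (take i xs)" "i \<in> I" for i l
      using size_in_restricted_trees[OF that(1)] that(2) I by auto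
    then show "\<forall>i\<in>I. \<forall>j\<in>I. i \<noteq> j \<longrightarrow>
        trees_with_root_at A B xs i \<inter> trees_with_root_at A B xs j = {}"
      by auto
  qed
  also have "\<dots> = (\<Sum>i\<in>I. card (restricted_trees A B (take i xs))
      * card (restricted_trees A B (drop (Suc i) xs)))"
    by (intro sum.cong refl, subst card_image)
      (auto simp: inj_on_def card_cartesian_product)
  finally show ?thesis .
qed

lemma card_restricted_trees_le: "real (card (restricted_trees A B xs)) \<le> catalan (length xs)"
proof (induction xs rule: length_induct)
  case (1 xs)
  show ?case
  proof (cases "length xs")
    case 0
    then show ?thesis by (simp add: catalan_0)
  next
    case (Suc n)
    have "card (restricted_trees A B xs) \<le> card (\<Union>i<length xs. trees_with_root_at A B xs i)"
      using Suc by (intro card_mono restricted_trees_subset_roots)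
        (auto intro!: finite_imageI finite_cartesian_product finite_restricted_trees)
    then have "real (card (restricted_trees A B xs)) \<le>
        (\<Sum>i<length xs. real (card (restricted_trees A B (take i xs)))
          * real (card (restricted_trees A B (drop (Suc i) xs))))"
      by (subst (asm) card_trees_with_root_in) (simp_all flip: of_nat_mult of_nat_sum)
    also have "\<dots> \<le> (\<Sum>i<Suc n. catalan i * catalan (n - i))"
    proof (unfold Suc, intro sum_mono mult_mono)
      fix i assume "i \<in> {..<Suc n}"
      with Suc have i: "length (take i xs) = i" "length (drop (Suc i) xs) = n - i"
        "i < length xs" by auto
      show "real (card (restricted_trees A B (take i xs))) \<le> catalan i"
        using 1[rule_format, of "take i xs"] i by simp
      show "real (card (restricted_trees A B (drop (Suc i) xs))) \<le> catalan (n - i)"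
        using 1[rule_format, of "drop (Suc i) xs"] i by simp
    qed (simp_all add: catalan_def)
    also have "\<dots> = catalan (length xs)"
      unfolding Suc by (rule catalan_convolution_lessThan)
    finally show ?thesis .
  qed
qed

text \<open>The new entry \<open>x\<close> becomes a childless left child of \<open>y\<close>, the
  lowest node on the left spine, which is allowed by \<open>\<not> A y\<close>. Being childless,
  \<open>x\<close> meets any prohibition of its own.\<close>

lemma insert_leftmost_restricted:
  assumes "t \<in> restricted_trees A B (y # ys)" "\<not> A y"
  shows "\<exists>t'. t' \<in> restricted_trees A B (x # y # ys)"
  using assms
proof (induction t arbitrary: ys)
  case Leaf
  then show ?case by (auto simp: restricted_trees_def)
next
  case (Node l a r)
  from Node.prems(1) obtain us zs where split: "y # ys = us @ a # zs"
    and l: "l \<in> restricted_trees A B us" and r: "r \<in> restricted_trees A B zs"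
    and ab: "A a \<longrightarrow> l = Leaf" "B a \<longrightarrow> r = Leaf"
    by (auto simp: Node_in_restricted_trees)
  show ?case
  proof (cases us)
    case Nil
    have "Node Leaf x Leaf \<in> restricted_trees A B [x]"
      by (simp add: restricted_trees_def)
    then have "Node (Node Leaf x Leaf) a r \<in> restricted_trees A B ([x] @ a # zs)"
      using Node.prems(2) r ab(2) split Nil by (intro Node_in_restricted_treesI) auto
    then show ?thesis using split Nil by auto
  next
    case (Cons u vs)
    then have "us = y # vs" using split by simp
    with Node.IH(1) l Node.prems(2) obtain l' where "l' \<in> restricted_trees A B (x # us)"
      by blast
    \<comment> \<open>Since \<open>l\<close> is nonempty, \<open>A a\<close> fails, so replacing
      \<open>l\<close> by a larger tree is harmless.\<close>
    moreover have "l \<noteq> Leaf" using l Cons inorder_in_restricted_trees by fastforce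
    ultimately have "Node l' a r \<in> restricted_trees A B ((x # us) @ a # zs)"
      using r ab by (intro Node_in_restricted_treesI) auto
    then show ?thesis using split by auto
  qed
qed

text \<open>The tree grows from the right end of the list. If \<open>x\<close> may have a right
  child, it becomes the root above the rest; otherwise compatibility permits the next entry a left
  child, and \<open>x\<close> is placed there.\<close>

lemma restricted_trees_nonempty:
  assumes "successively (\<lambda>x y. \<not> (B x \<and> A y)) xs"
  shows "restricted_trees A B xs \<noteq> {}"
  using assms
proof (induction xs)
  case (Cons x xs)
  then obtain t where t: "t \<in> restricted_trees A B xs"
    by (auto simp: successively_Cons)
  show ?case
  proof (cases "B x \<and> xs \<noteq> []")
    case True
    then obtain y ys where "xs = y # ys" by (cases xs) auto
    then show ?thesis
      using insert_leftmost_restricted[of t A B y ys x] t True Cons.prems by auto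
  next
    case False
    then have "Node Leaf x t \<in> restricted_trees A B ([] @ x # xs)"
      using t inorder_in_restricted_trees[OF t] by (intro Node_in_restricted_treesI) auto
    then show ?thesis by auto
  qed
qed simp

text \<open>Reindexing by rank: the number of earlier entries satisfying \<open>P\<close> runs once
  through 0, 1, and so on. This turns a sum over free roots into a Catalan convolution.\<close>

lemma sum_filter_rank:
  "(\<Sum>i | i < length xs \<and> P (xs ! i). g (length (filter P (take i xs))))
     = (\<Sum>j<length (filter P xs). g j)"
proof (induction xs rule: rev_induct)
  case (snoc x xs)
  have *: "{i. i < length (xs @ [x]) \<and> P ((xs @ [x]) ! i)}
      = {i. i < length xs \<and> P (xs ! i)} \<union> (if P x then {length xs} else {})"
    by (auto simp: nth_append less_Suc_eq)
  have "(\<Sum>i | i < length xs \<and> P (xs ! i). g (length (filter P (take i (xs @ [x])))))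
      = (\<Sum>j<length (filter P xs). g j)"
    unfolding snoc.IH[symmetric] by (rule sum.cong) auto
  then show ?case
    unfolding * by (subst sum.union_disjoint) (auto simp: add.commute)
qed simp

lemma card_restricted_trees_ge:
  assumes "successively (\<lambda>x y. \<not> (B x \<and> A y)) xs"
  shows "catalan (length (filter (\<lambda>x. \<not> A x \<and> \<not> B x) xs)) \<le> real (card (restricted_trees A B xs))"
  using assms
proof (induction xs rule: length_induct)
  case (1 xs)
  let ?free = "\<lambda>x. \<not> A x \<and> \<not> B x"
  let ?m = "\<lambda>xs. length (filter ?free xs)"
  let ?I = "{i. i < length xs \<and> ?free (xs ! i)}"
  show ?case
  proof (cases "?m xs")
    case 0
    \<comment> \<open>Without free entries the bound is \<open>catalan 0 = 1\<close>, so one tree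
      suffices; finiteness keeps \<open>card\<close> from defaulting to 0.\<close>
    have "card (restricted_trees A B xs) \<noteq> 0"
      using restricted_trees_nonempty[of B A xs] 1(2) finite_restricted_trees[of A B xs] by simp
    then show ?thesis unfolding 0 by (simp add: catalan_0)
  next
    case (Suc n)
    have "catalan (?m xs) = (\<Sum>j<?m xs. catalan j * catalan (n - j))"
      unfolding Suc by (rule catalan_convolution_lessThan[symmetric])
    also have "\<dots> = (\<Sum>i\<in>?I. catalan (?m (take i xs)) * catalan (n - ?m (take i xs)))"
      by (rule sum_filter_rank[symmetric])
    also have "\<dots> \<le> (\<Sum>i\<in>?I. real (card (restricted_trees A B (take i xs)))
        * real (card (restricted_trees A B (drop (Suc i) xs))))"
    proof (intro sum_mono mult_mono)
      fix i assume i: "i \<in> ?I"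
      then have xs: "xs = take i xs @ xs ! i # drop (Suc i) xs"
        by (auto intro: id_take_nth_drop)
      \<comment> \<open>The free root accounts for the \<open>Suc\<close>, which cancels the one in
        \<open>?m xs = Suc n\<close>.\<close>
      have "?m xs = ?m (take i xs) + Suc (?m (drop (Suc i) xs))"
        using i by (subst xs) simp
      then have m: "n - ?m (take i xs) = ?m (drop (Suc i) xs)"
        using Suc by simp
      have "successively (\<lambda>x y. \<not> (B x \<and> A y)) (take i xs @ xs ! i # drop (Suc i) xs)"
        using 1(2) xs by metis
      then have succ: "successively (\<lambda>x y. \<not> (B x \<and> A y)) (take i xs)"
        "successively (\<lambda>x y. \<not> (B x \<and> A y)) (drop (Suc i) xs)"
        unfolding successively_append_iff successively_Cons by auto
      show "catalan (?m (take i xs)) \<le> real (card (restricted_trees A B (take i xs)))"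
        using 1(1)[rule_format, of "take i xs"] i succ by auto
      show "catalan (n - ?m (take i xs)) \<le> real (card (restricted_trees A B (drop (Suc i) xs)))"
        unfolding m using 1(1)[rule_format, of "drop (Suc i) xs"] i succ by auto
    qed (simp_all add: catalan_def)
    also have "\<dots> = real (card (\<Union>i\<in>?I. trees_with_root_at A B xs i))"
      by (subst card_trees_with_root_in) auto
    also have "\<dots> \<le> real (card (restricted_trees A B xs))"
      using trees_with_free_root_subset[of _ xs A B]
      by (intro of_nat_mono card_mono finite_restricted_trees) blast
    finally show ?thesis .
  qed
qed

section \<open>Twins as restricted trees\<close>

text \<open>Being a BSTM depends on the inorder list alone, so every rearrangement of the nodes that
  keeps this list is again a BSTM.\<close>

lemma bstm_iff_inorder:
  "bstm T \<longleftrightarrow> sorted_wrt (<) (map fst (inorder T)) \<and> (\<forall>(a, m) \<in> set (inorder T). 0 < a \<and> 0 < m)"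
  by (simp add: bstm_def bst_iff_sorted_wrt_less inorder_map)

lemma bstm_distinct_keys: "bstm T \<Longrightarrow> distinct (map fst (inorder T))"
  by (simp add: bstm_iff_inorder strict_sorted_iff)

text \<open>Multiplicities are positive, so the value 0 of \<open>cont\<close> unambiguously marks
  an absent letter.\<close>

lemma map_of_inorder_bstm:
  assumes "bstm T"
  shows "map_of (inorder T) a = (if cont T a = 0 then None else Some (cont T a))"
proof (cases "map_of (inorder T) a")
  case (Some m)
  then have "0 < m" using assms map_of_SomeD by (fastforce simp: bstm_iff_inorder)
  with Some show ?thesis by (simp add: cont_def)
qed (simp add: cont_def)

text \<open>Equal contents give equal lookup maps, hence equal sets of entries; sorting by letter
  leaves only one list with a given set.\<close>

lemma bstm_cont_eq_iff_inorder:
  assumes "bstm S" "bstm T"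
  shows "cont S = cont T \<longleftrightarrow> inorder S = inorder T"
proof
  assume "cont S = cont T"
  then have "map_of (inorder S) = map_of (inorder T)"
    using assms by (auto simp: map_of_inorder_bstm)
  then have set: "set (inorder S) = set (inorder T)"
    using map_of_inject_set bstm_distinct_keys assms by blast
  have dist: "distinct (map fst (inorder T))" "distinct (map fst (inorder S))"
    using assms by (simp_all add: bstm_distinct_keys)
  then have "inj_on fst (set (inorder S) \<union> set (inorder T))"
    using set by (simp add: distinct_map)
  then show "inorder S = inorder T"
    using assms dist set
    by (intro map_sorted_distinct_set_unique[of fst])
      (auto simp: bstm_iff_inorder strict_sorted_iff)
qed (simp add: cont_def fun_eq_iff)

text \<open>Phrased for an entry instead of an index, to serve as a predicate in
  \<open>restricted_trees\<close>. In a BSTM the letters are distinct, so at most one node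
  \<open>s\<close> qualifies.\<close>

definition simple_with_left :: "labelled_tree \<Rightarrow> nat \<times> nat \<Rightarrow> bool" where
  "simple_with_left T p \<longleftrightarrow> snd p = 1 \<and> (\<exists>s\<in>set (inorder_nodes T). value s = p \<and> left s \<noteq> Leaf)"

definition simple_with_right :: "labelled_tree \<Rightarrow> nat \<times> nat \<Rightarrow> bool" where
  "simple_with_right T p \<longleftrightarrow> snd p = 1 \<and> (\<exists>s\<in>set (inorder_nodes T). value s = p \<and> right s \<noteq> Leaf)"

lemma bstm_node_with_value_iff:
  assumes "bstm T" "i < size T"
  shows "s \<in> set (inorder_nodes T) \<and> value s = inorder T ! i \<longleftrightarrow> s = node_at T i"
proof -
  have "distinct (map value (inorder_nodes T))"
    using bstm_distinct_keys[OF assms(1)] by (simp add: map_value_inorder_nodes distinct_map)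
  then have "inj_on value (set (inorder_nodes T))"
    by (simp add: distinct_map)
  then show ?thesis
    using assms node_at_in_nodes value_node_at by (metis inj_onD)
qed

lemma simple_with_left_nth:
  assumes "bstm T" "i < size T"
  shows "simple_with_left T (inorder T ! i) \<longleftrightarrow> mult_at T i = 1 \<and> has_left_child T i"
  unfolding simple_with_left_def Bex_def conj_assoc[symmetric]
    bstm_node_with_value_iff[OF assms] mult_at_def has_left_child_def value_node_at[OF assms(2)]
  by blast

lemma simple_with_right_nth:
  assumes "bstm T" "i < size T"
  shows "simple_with_right T (inorder T ! i) \<longleftrightarrow> mult_at T i = 1 \<and> has_right_child T i"
  unfolding simple_with_right_def Bex_def conj_assoc[symmetric]
    bstm_node_with_value_iff[OF assms] mult_at_def has_right_child_def value_node_at[OF assms(2)]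
  by blast

lemma ball_inorder_nodes_iff:
  "(\<forall>s\<in>set (inorder_nodes t). P s) \<longleftrightarrow> (\<forall>i<size t. P (node_at t i))"
  by (simp add: all_set_conv_all_nth node_at_def)

text \<open>Twins share their inorder list, so the nodes with index \<open>i\<close> carry the same
  entry, and conditions on indices become conditions on labels.\<close>

lemma twins_eq_restricted_trees:
  assumes "bstm T"
  shows "{S. twin_bstms T S}
    = restricted_trees (simple_with_left T) (simple_with_right T) (inorder T)"
proof (intro set_eqI iffI; unfold mem_Collect_eq)
  fix S assume twin: "twin_bstms T S"
  then have io: "inorder S = inorder T"
    using bstm_cont_eq_iff_inorder by (metis twin_bstms_def)
  then have size: "size S = size T"
    by (metis length_inorder)
  show "S \<in> restricted_trees (simple_with_left T) (simple_with_right T) (inorder T)"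
    using twin io size
    by (auto simp: restricted_trees_def ball_inorder_nodes_iff value_node_at assms
        simple_with_left_nth simple_with_right_nth twin_bstms_def has_left_child_def
        has_right_child_def)
next
  fix S assume S: "S \<in> restricted_trees (simple_with_left T) (simple_with_right T) (inorder T)"
  then have io: "inorder S = inorder T"
    by (rule inorder_in_restricted_trees)
  then have size: "size S = size T"
    by (metis length_inorder)
  have "bstm S" using assms io by (simp add: bstm_iff_inorder)
  moreover have "cont T = cont S" using io by (simp add: cont_def fun_eq_iff)
  moreover have "mult_at T i = mult_at S i" if "i < size T" for i
    using that size io by (simp add: mult_at_def value_node_at)
  ultimately show "twin_bstms T S"
    using S io size
    by (auto simp: restricted_trees_def ball_inorder_nodes_iff value_node_at assms
        simple_with_left_nth simple_with_right_nth twin_bstms_def has_left_child_def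
        has_right_child_def)
qed

text \<open>The canopy property of \<open>T\<close> itself supplies the compatibility that the lower
  bound requires.\<close>

lemma simple_with_children_compatible:
  assumes "bstm T"
  shows "successively (\<lambda>p q. \<not> (simple_with_right T p \<and> simple_with_left T q)) (inorder T)"
  unfolding successively_conv_nth
proof (intro allI impI)
  fix i assume i: "Suc i < length (inorder T)"
  then have "right (node_at T i) = Leaf \<or> left (node_at T (Suc i)) = Leaf"
    using inorder_nodes_canopy[of T] by (simp add: successively_conv_nth node_at_def)
  then show "\<not> (simple_with_right T (inorder T ! i) \<and> simple_with_left T (inorder T ! Suc i))"
    using simple_with_right_nth[OF assms, of i] simple_with_left_nth[OF assms, of "Suc i"] i
    unfolding has_left_child_def has_right_child_def length_inorder by linarith
qed

theorem proposition5p11: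
  fixes T\<^sub>L :: labelled_tree and n k :: nat
  assumes "bstm T\<^sub>L"
    and "size T\<^sub>L = n"
    and "card {i. i < n \<and> simple_node T\<^sub>L i \<and> \<not> leaf_node T\<^sub>L i} = k"
  shows "catalan (n - k) \<le> real (num_right_twins T\<^sub>L) \<and>
         real (num_right_twins T\<^sub>L) \<le> catalan n"
proof -
  let ?A = "simple_with_left T\<^sub>L" and ?B = "simple_with_right T\<^sub>L" and ?xs = "inorder T\<^sub>L"
  \<comment> \<open>A simple node is no leaf exactly if it has a left or a right child, that is, if
    its entry is not free. The doubly negated form matches the complement in
    \<open>sum_length_filter_compl\<close>.\<close>
  have "{i. i < n \<and> simple_node T\<^sub>L i \<and> \<not> leaf_node T\<^sub>L i}
      = {i. i < length ?xs \<and> \<not> (\<not> ?A (?xs ! i) \<and> \<not> ?B (?xs ! i))}"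
    using assms(1,2)
    by (auto simp: simple_with_left_nth simple_with_right_nth simple_node_def leaf_node_def)
  then have "length (filter (\<lambda>p. \<not> (\<not> ?A p \<and> \<not> ?B p)) ?xs) = k"
    using assms(3) by (simp only: length_filter_conv_card)
  then have "length (filter (\<lambda>p. \<not> ?A p \<and> \<not> ?B p) ?xs) = n - k"
    using sum_length_filter_compl[of "\<lambda>p. \<not> ?A p \<and> \<not> ?B p" ?xs] assms(2) by simp
  then show ?thesis
    using card_restricted_trees_ge[OF simple_with_children_compatible[OF assms(1)]]
      card_restricted_trees_le[of ?A ?B ?xs] assms(2)
    by (simp add: num_right_twins_def twins_eq_restricted_trees[OF assms(1)])
qed

end
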